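(* (High SNR slope with friendly jamming.) Let $0<\alpha<1$, $0<\eta<1$, $\beta=\frac{1-\alpha}{2\eta\alpha}$, $\xi>0$, and let $p_R,p_J\in[0,1]$ be constants (the power outage probabilities at the relay and the jammer). Let $X,Y,Z,W,U$ be independent exponential random variables with positive means $m_x,m_y,m_z,m_w,m_u$. For $\rho>0$ define $$\bar R_{Sec}^{WoJ}(\rho)=(1-p_R)\,\mathbb E\left\{\left[\frac{1-\alpha}{2}\log_2\frac{\left(1+\frac{\rho XY}{X+\beta}\right)\left(1+\frac{\xi\rho XY}{Y+\beta}\right)}{1+\rho(\xi X+Y)}\right]^+\right\},$$ $$\gamma_R=\frac{\rho(\xi X+Y)}{\beta^{-1}\rho(\xi Z+W)U+1},\quad \gamma_{S_1}=\frac{\rho XY}{X+\frac{\xi Z+W}{\xi X+Y}U+\beta},\quad \gamma_{S_2}=\frac{\xi\rho XY}{Y+\frac{\xi Z+W}{\xi X+Y}U+\beta},$$ $$\bar R_{Act}^{FJ}(\rho)=\mathbb E\left\{\left[\frac{1-\alpha}{2}\log_2\frac{(1+\gamma_{S_1})(1+\gamma_{S_2})}{1+\gamma_R}\right]^+\right\},$$ $$\bar R_{Sec}^{FJ}(\rho)=p_J\,\bar R_{Sec}^{WoJ}(\rho)+(1-p_R)(1-p_J)\,\bar R_{Act}^{FJ}(\rho).$$ Then the high SNR slope is $$S_\infty^{FJ}:=\lim_{\rho\to\infty}\frac{\bar R_{Sec}^{FJ}(\rho)}{\log_2\rho}=(1-p_R)\left(1-\frac{p_J}{2}\right)(1-\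alpha).$$
   Context: $[x]^+=\max(x,0)$. In the model, two sources with transmit powers $P_1=\xi P_2$ communicate through an untrusted energy-harvesting relay, with the help of an energy-harvesting jammer whose signal is known to the sources; $\rho=P_2/N_0$ is the transmit SNR ($N_0$ the noise power); $X,Y$ are the channel power gains from sources 1, 2 to the relay, $Z,W$ those from sources 1, 2 to the jammer, $U$ that of jammer–relay; $\bar R_{Sec}^{FJ}$ is the ergodic secrecy sum rate. *)

theory Defs
  imports "HOL-Probability.Probability"
begin

(* Realizations of the channel power gains are lower-case reals:
   x, y : source 1, 2 -- relay;  z, w : source 1, 2 -- jammer;  u : jammer -- relay. *)

definition pos_part :: "real \<Rightarrow> real" where
  "pos_part x = max x 0"

definition eh_beta :: "real \<Rightarrow> real \<Rightarrow> real" where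
  "eh_beta \<alpha> \<eta> = (1 - \<alpha>) / (2 * \<eta> * \<alpha>)"

definition gamma_R :: "real \<Rightarrow> real \<Rightarrow> real \<Rightarrow> real \<Rightarrow> real \<Rightarrow> real \<Rightarrow> real \<Rightarrow> real \<Rightarrow> real" where
  "gamma_R \<beta> \<xi> \<rho> x y z w u =
     \<rho> * (\<xi> * x + y) / (inverse \<beta> * \<rho> * (\<xi> * z + w) * u + 1)"

definition gamma_S1 :: "real \<Rightarrow> real \<Rightarrow> real \<Rightarrow> real \<Rightarrow> real \<Rightarrow> real \<Rightarrow> real \<Rightarrow> real \<Rightarrow> real" where
  "gamma_S1 \<beta> \<xi> \<rho> x y z w u =
     \<rho> * x * y / (x + (\<xi> * z + w) / (\<xi> * x + y) * u + \<beta>)"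

definition gamma_S2 :: "real \<Rightarrow> real \<Rightarrow> real \<Rightarrow> real \<Rightarrow> real \<Rightarrow> real \<Rightarrow> real \<Rightarrow> real \<Rightarrow> real" where
  "gamma_S2 \<beta> \<xi> \<rho> x y z w u =
     \<xi> * \<rho> * x * y / (y + (\<xi> * z + w) / (\<xi> * x + y) * u + \<beta>)"

(* Ergodic secrecy sum rate without jamming; p is the relay's power outage probability. *)
definition R_Sec_WoJ ::
  "'a measure \<Rightarrow> real \<Rightarrow> real \<Rightarrow> real \<Rightarrow> real \<Rightarrow> ('a \<Rightarrow> real) \<Rightarrow> ('a \<Rightarrow> real) \<Rightarrow> real \<Rightarrow> real" where
  "R_Sec_WoJ M \<alpha> \<eta> \<xi> p X Y \<rho> =
     (let \<beta> = eh_beta \<alpha> \<eta> in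
      (1 - p) * (\<integral>\<omega>. pos_part ((1 - \<alpha>) / 2 * log 2
          ((1 + \<rho> * X \<omega> * Y \<omega> / (X \<omega> + \<beta>)) * (1 + \<xi> * \<rho> * X \<omega> * Y \<omega> / (Y \<omega> + \<beta>))
           / (1 + \<rho> * (\<xi> * X \<omega> + Y \<omega>)))) \<partial>M))"

definition R_Act_FJ ::
  "'a measure \<Rightarrow> real \<Rightarrow> real \<Rightarrow> real \<Rightarrow> ('a \<Rightarrow> real) \<Rightarrow> ('a \<Rightarrow> real) \<Rightarrow> ('a \<Rightarrow> real)
     \<Rightarrow> ('a \<Rightarrow> real) \<Rightarrow> ('a \<Rightarrow> real) \<Rightarrow> real \<Rightarrow> real" where
  "R_Act_FJ M \<alpha> \<eta> \<xi> X Y Z W U \<rho> =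
     (let \<beta> = eh_beta \<alpha> \<eta> in
      (\<integral>\<omega>. pos_part ((1 - \<alpha>) / 2 * log 2
          ((1 + gamma_S1 \<beta> \<xi> \<rho> (X \<omega>) (Y \<omega>) (Z \<omega>) (W \<omega>) (U \<omega>))
           * (1 + gamma_S2 \<beta> \<xi> \<rho> (X \<omega>) (Y \<omega>) (Z \<omega>) (W \<omega>) (U \<omega>))
           / (1 + gamma_R \<beta> \<xi> \<rho> (X \<omega>) (Y \<omega>) (Z \<omega>) (W \<omega>) (U \<omega>)))) \<partial>M))"

definition R_Sec_FJ ::
  "'a measure \<Rightarrow> real \<Rightarrow> real \<Rightarrow> real \<Rightarrow> real \<Rightarrow> real \<Rightarrow> ('a \<Rightarrow> real) \<Rightarrow> ('a \<Rightarrow> real)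
     \<Rightarrow> ('a \<Rightarrow> real) \<Rightarrow> ('a \<Rightarrow> real) \<Rightarrow> ('a \<Rightarrow> real) \<Rightarrow> real \<Rightarrow> real" where
  "R_Sec_FJ M \<alpha> \<eta> \<xi> p_R p_J X Y Z W U \<rho> =
     p_J * R_Sec_WoJ M \<alpha> \<eta> \<xi> p_R X Y \<rho>
     + (1 - p_R) * (1 - p_J) * R_Act_FJ M \<alpha> \<eta> \<xi> X Y Z W U \<rho>"

end

theory Submission
  imports Defs "HOL-Real_Asymp.Real_Asymp"
begin

text \<open>Almost surely all gains are positive. Without jamming, the logarithm of the rate has two
  factors of order \<open>\<rho>\<close> in the numerator and one in the denominator, so after division by
  \<open>log 2 \<rho>\<close> it tends to \<open>1\<close>. With jamming, the SNR at the relay stays bounded in \<open>\<rho>\<close>,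
  so the limit is \<open>2\<close>. For \<open>\<rho> \<ge> 2\<close> both quotients are dominated by an affine function of the
  integrable gains \<open>X\<close> and \<open>Y\<close>, and limit and expectation may be exchanged.\<close>

text \<open>The argument of the logarithm behaves like \<rho> * a * b / c. The constant a * b / c
  adds only a bounded term to the logarithm, which vanishes after division by
  \<open>log 2 \<rho>\<close>.\<close>

lemma slope_quotient_linear:
  fixes a b c :: real
  assumes "a > 0" "b > 0" "c > 0"
  shows "((\<lambda>\<rho>. log 2 ((1 + a * \<rho>) * (1 + b * \<rho>) / (1 + c * \<rho>)) / log 2 \<rho>) \<longlongrightarrow> 1) at_top"
  using assms unfolding log_def by real_asymp

lemma slope_quotient_bounded:
  fixes a b c d :: real
  assumes "a > 0" "b > 0" "c > 0" "d > 0"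
  shows "((\<lambda>\<rho>. log 2 ((1 + a * \<rho>) * (1 + b * \<rho>) / (1 + c * \<rho> / (d * \<rho> + 1))) / log 2 \<rho>)
           \<longlongrightarrow> 2) at_top"
proof -
  \<comment> \<open>Clearing the inner fraction turns the denominator into (1 + e * \<rho>) / (d *
    \<rho> + 1). Three linear factors then stand over one, so the growth is of order \<rho>
    squared.\<close>
  define e where "e = c + d"
  have e: "e > 0" using assms by (simp add: e_def)
  have "((\<lambda>\<rho>. log 2 ((1 + a * \<rho>) * (1 + b * \<rho>) * (d * \<rho> + 1) / (1 + e * \<rho>)) / log 2 \<rho>)
           \<longlongrightarrow> 2) at_top"
    using assms e unfolding log_def by real_asymp
  moreover have "\<forall>\<^sub>F \<rho> in at_top.
      log 2 ((1 + a * \<rho>) * (1 + b * \<rho>) * (d * \<rho> + 1) / (1 + e * \<rho>)) / log 2 \<rho>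
      = log 2 ((1 + a * \<rho>) * (1 + b * \<rho>) / (1 + c * \<rho> / (d * \<rho> + 1))) / log 2 \<rho>"
    using eventually_gt_at_top[of 0]
  proof eventually_elim
    case (elim \<rho>)
    have "d * \<rho> + 1 > 0" using elim assms by (simp add: add_pos_pos)
    then have "1 + c * \<rho> / (d * \<rho> + 1) = (1 + e * \<rho>) / (d * \<rho> + 1)"
      by (simp add: e_def field_simps)
    then show ?case by simp
  qed
  ultimately show ?thesis by (rule Lim_transform_eventually)
qed

text \<open>This separates \<rho> from the gain: after division by \<open>log 2 \<rho>\<close> the
  bound is affine in y and free of \<rho>, as a dominating function must be.\<close>

lemma log2_one_plus_mult_le:
  fixes y \<rho> :: real
  assumes "0 \<le> y" "2 \<le> \<rho>"
  shows "log 2 (1 + \<rho> * y) \<le> log 2 \<rho> * (1 + y / ln 2)"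
proof -
  have "log 2 (1 + \<rho> * y) \<le> log 2 (\<rho> * (1 + y))"
    using assms by (intro log_mono) (auto simp: algebra_simps add_pos_nonneg)
  also have "\<dots> = log 2 \<rho> + log 2 (1 + y)"
    using assms by (simp add: log_mult)
  also have "log 2 (1 + y) \<le> y / ln 2"
    unfolding log_def using assms by (intro divide_right_mono ln_add_one_self_le_self) auto
  \<comment> \<open>Here \<rho> \<ge> 2 enters in full: it gives \<open>log 2 \<rho>\<close> \<ge>
    1.\<close>
  also have "y / ln 2 \<le> log 2 \<rho> * (y / ln 2)"
    using mult_right_mono[of 1 "log 2 \<rho>" "y / ln 2"] assms by (simp add: le_log_iff)
  finally show ?thesis by (simp add: algebra_simps)
qed

text \<open>The common engine for both rates: \<open>F\<close> is the argument of the logarithm,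
  \<open>k\<close> the prefactor and \<open>l\<close> the pointwise slope. The positive part cuts
  off negative values, so the upper bound on \<open>F\<close> already bounds the integrand in
  absolute value, and dominated convergence applies.\<close>

lemma (in prob_space) ergodic_slope:
  fixes F :: "real \<Rightarrow> 'a \<Rightarrow> real" and S T :: "'a \<Rightarrow> real" and k l :: real
  assumes meas [measurable]: "\<And>\<rho>. F \<rho> \<in> borel_measurable M"
    and "0 \<le> k" "0 \<le> l"
    and int: "integrable M S" "integrable M T"
    and nonneg: "AE \<omega> in M. 0 \<le> S \<omega> \<and> 0 \<le> T \<omega>"
    and bound: "AE \<omega> in M. \<forall>\<rho>\<ge>2. 0 < F \<rho> \<omega> \<and> F \<rho> \<omega> \<le> (1 + \<rho> * S \<omega>) * (1 + \<rho> * T \<omega>)"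
    and lim: "AE \<omega> in M. ((\<lambda>\<rho>. log 2 (F \<rho> \<omega>) / log 2 \<rho>) \<longlongrightarrow> l) at_top"
  shows "((\<lambda>\<rho>. (\<integral>\<omega>. pos_part (k * log 2 (F \<rho> \<omega>)) \<partial>M) / log 2 \<rho>) \<longlongrightarrow> k * l) at_top"
proof -
  define G where "G \<rho> \<omega> = pos_part (k * log 2 (F \<rho> \<omega>)) / log 2 \<rho>" for \<rho> \<omega>
  \<comment> \<open>The dominating function: \<open>k\<close> times the sum of the \<rho>-free
    factors that \<open>log2_one_plus_mult_le\<close> gives for \<open>S\<close> and
    \<open>T\<close>.\<close>
  define w where "w \<omega> = k * ((1 + S \<omega> / ln 2) + (1 + T \<omega> / ln 2))" for \<omega>
  have [measurable]: "G \<rho> \<in> borel_measurable M" for \<rho>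
    unfolding G_def pos_part_def by measurable
  have "((\<lambda>\<rho>. \<integral>\<omega>. G \<rho> \<omega> \<partial>M) \<longlongrightarrow> (\<integral>\<omega>. k * l \<partial>M)) at_top"
  proof (rule integral_dominated_convergence_at_top)
    show "integrable M w"
      unfolding w_def using int by auto
    show "AE \<omega> in M. ((\<lambda>\<rho>. G \<rho> \<omega>) \<longlongrightarrow> k * l) at_top"
      using lim
    proof eventually_elim
      case (elim \<omega>)
      have "((\<lambda>\<rho>. max (k * (log 2 (F \<rho> \<omega>) / log 2 \<rho>)) 0) \<longlongrightarrow> max (k * l) 0) at_top"
        by (intro tendsto_max tendsto_mult elim tendsto_const)
      \<comment> \<open>For \<rho> > 1 the divisor \<open>log 2 \<rho>\<close> is positive, so the
        division can be moved inside the maximum.\<close>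
      moreover have "\<forall>\<^sub>F \<rho> in at_top. max (k * (log 2 (F \<rho> \<omega>) / log 2 \<rho>)) 0 = G \<rho> \<omega>"
        using eventually_gt_at_top[of 1]
        by eventually_elim (auto simp: G_def pos_part_def max_def field_simps)
      moreover have "max (k * l) 0 = k * l"
        using assms by simp
      ultimately show ?case
        by (metis Lim_transform_eventually)
    qed
    show "\<forall>\<^sub>F \<rho> in at_top. AE \<omega> in M. norm (G \<rho> \<omega>) \<le> w \<omega>"
      using eventually_ge_at_top[of 2]
    proof eventually_elim
      case (elim \<rho>)
      show ?case using bound nonneg
      proof eventually_elim
        case inner: (elim \<omega>)
        then have F: "0 < F \<rho> \<omega>" "F \<rho> \<omega> \<le> (1 + \<rho> * S \<omega>) * (1 + \<rho> * T \<omega>)"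
          and pos: "0 \<le> S \<omega>" "0 \<le> T \<omega>"
          using elim by auto
        have \<rho>: "0 < log 2 \<rho>" using elim by simp
        have ge1: "1 \<le> 1 + \<rho> * S \<omega>" "1 \<le> 1 + \<rho> * T \<omega>" using elim pos by auto
        have "log 2 (F \<rho> \<omega>) \<le> log 2 ((1 + \<rho> * S \<omega>) * (1 + \<rho> * T \<omega>))"
          using F by (intro log_mono) auto
        also have "\<dots> = log 2 (1 + \<rho> * S \<omega>) + log 2 (1 + \<rho> * T \<omega>)"
          using ge1 by (subst log_mult) auto
        also have "\<dots> \<le> log 2 \<rho> * (1 + S \<omega> / ln 2) + log 2 \<rho> * (1 + T \<omega> / ln 2)"
          using elim pos by (intro add_mono log2_one_plus_mult_le) auto
        finally have "k * log 2 (F \<rho> \<omega>) \<le> k * (log 2 \<rho> * (1 + S \<omega> / ln 2) + log 2 \<rho> * (1 + T \<omega> / ln 2))"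
          using \<open>0 \<le> k\<close> by (rule mult_left_mono)
        also have "\<dots> = w \<omega> * log 2 \<rho>" by (simp add: w_def algebra_simps)
        finally have "k * log 2 (F \<rho> \<omega>) \<le> w \<omega> * log 2 \<rho>" .
        moreover have "0 \<le> w \<omega> * log 2 \<rho>"
          using \<rho> pos \<open>0 \<le> k\<close> by (simp add: w_def)
        ultimately have "pos_part (k * log 2 (F \<rho> \<omega>)) \<le> w \<omega> * log 2 \<rho>"
          by (simp add: pos_part_def)
        moreover have "0 \<le> pos_part (k * log 2 (F \<rho> \<omega>))"
          by (simp add: pos_part_def)
        ultimately show ?case
          using \<rho> by (simp add: G_def pos_divide_le_eq)
      qed
    qed
  qed auto
  then show ?thesis by (simp add: G_def prob_space)
qed

text \<open>The density vanishes at negative arguments, so only the value 0 is left to exclude, and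
  a single point is a Lebesgue null set.\<close>

lemma (in prob_space) exponential_distributed_AE_pos:
  assumes "distributed M lborel X (exponential_density l)"
  shows "AE \<omega> in M. 0 < X \<omega>"
proof -
  have "AE x in lborel. x \<noteq> (0::real)"
    by (rule AE_lborel_singleton)
  then have "AE x in lborel. 0 < exponential_density l x \<longrightarrow> 0 < x"
    by eventually_elim (auto simp: exponential_density_def split: if_splits)
  then show ?thesis
    by (subst distributed_AE2[OF assms]) auto
qed

lemma (in prob_space) exponential_distributed_integrable:
  assumes "0 < l" "distributed M lborel X (exponential_density l)"
  shows "integrable M X"
  \<comment> \<open>The exponential density is the Erlang density with index 0; the moment of order
    1 is the one wanted.\<close>
  using erlang_ith_moment_integrable[OF assms, of 1] by simp

text \<open>Dropping \<open>s\<close> from the denominators cancels x in the first factor and y in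
  the second, and division by 1 + c \<ge> 1 only lowers the product. Here \<open>c\<close> stands
  for the SNR at the relay, and \<open>s\<close> for \<beta> or for \<beta> plus the jamming term,
  so both rates are covered.\<close>

lemma secrecy_quotient_bounds:
  fixes x y s c \<xi> \<rho> :: real
  assumes "0 < x" "0 < y" "0 < s" "0 < \<xi>" "0 < \<rho>" "0 \<le> c"
  shows "0 < (1 + \<rho> * x * y / (x + s)) * (1 + \<xi> * \<rho> * x * y / (y + s)) / (1 + c) \<and>
    (1 + \<rho> * x * y / (x + s)) * (1 + \<xi> * \<rho> * x * y / (y + s)) / (1 + c)
      \<le> (1 + \<rho> * y) * (1 + \<rho> * (\<xi> * x))"
proof
  let ?A = "1 + \<rho> * x * y / (x + s)" and ?B = "1 + \<xi> * \<rho> * x * y / (y + s)"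
  have pos: "0 < ?A" "0 < ?B" using assms by (auto intro!: add_pos_nonneg)
  then show "0 < ?A * ?B / (1 + c)" using assms by simp
  have le: "?A \<le> 1 + \<rho> * y" "?B \<le> 1 + \<rho> * (\<xi> * x)"
    using assms by (simp_all add: pos_divide_le_eq algebra_simps)
  have "?A * ?B / (1 + c) \<le> ?A * ?B"
    using pos assms by (simp add: pos_divide_le_eq)
  also have "\<dots> \<le> (1 + \<rho> * y) * (1 + \<rho> * (\<xi> * x))"
    using le pos by (intro mult_mono) auto
  finally show "?A * ?B / (1 + c) \<le> (1 + \<rho> * y) * (1 + \<rho> * (\<xi> * x))" .
qed

lemma (in prob_space) R_Sec_WoJ_slope:
  fixes X Y :: "'a \<Rightarrow> real"
  assumes "\<alpha> \<le> 1" and \<beta>: "0 < eh_beta \<alpha> \<eta>" and \<xi>: "0 < \<xi>"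
    and int: "integrable M X" "integrable M Y"
    and pos: "AE \<omega> in M. 0 < X \<omega> \<and> 0 < Y \<omega>"
  shows "((\<lambda>\<rho>. R_Sec_WoJ M \<alpha> \<eta> \<xi> p X Y \<rho> / log 2 \<rho>) \<longlongrightarrow> (1 - p) * ((1 - \<alpha>) / 2)) at_top"
proof -
  define \<beta> where "\<beta> = eh_beta \<alpha> \<eta>"
  have \<beta>0: "0 < \<beta>" using \<beta> by (simp add: \<beta>_def)
  define F where "F \<rho> \<omega> = (1 + \<rho> * X \<omega> * Y \<omega> / (X \<omega> + \<beta>)) * (1 + \<xi> * \<rho> * X \<omega> * Y \<omega> / (Y \<omega> + \<beta>))
     / (1 + \<rho> * (\<xi> * X \<omega> + Y \<omega>))" for \<rho> \<omega>
  have [measurable]: "X \<in> borel_measurable M" "Y \<in> borel_measurable M"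
    using int by auto
  have "((\<lambda>\<rho>. (\<integral>\<omega>. pos_part ((1 - \<alpha>) / 2 * log 2 (F \<rho> \<omega>)) \<partial>M) / log 2 \<rho>)
          \<longlongrightarrow> (1 - \<alpha>) / 2 * 1) at_top"
  \<comment> \<open>The gains cross over: the factor with X in its denominator is bounded through Y,
    and the factor with Y through \<xi> * X.\<close>
  proof (rule ergodic_slope[where S = Y and T = "\<lambda>\<omega>. \<xi> * X \<omega>"])
    show "F \<rho> \<in> borel_measurable M" for \<rho>
      unfolding F_def by measurable
    show "AE \<omega> in M. \<forall>\<rho>\<ge>2. 0 < F \<rho> \<omega> \<and> F \<rho> \<omega> \<le> (1 + \<rho> * Y \<omega>) * (1 + \<rho> * (\<xi> * X \<omega>))"
      using pos
    proof eventually_elim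
      case (elim \<omega>)
      show ?case
      proof (intro allI impI)
        fix \<rho> :: real assume \<rho>: "2 \<le> \<rho>"
        show "0 < F \<rho> \<omega> \<and> F \<rho> \<omega> \<le> (1 + \<rho> * Y \<omega>) * (1 + \<rho> * (\<xi> * X \<omega>))"
          unfolding F_def
          by (rule secrecy_quotient_bounds) (use elim \<rho> \<xi> \<beta>0 in auto)
      qed
    qed
    show "AE \<omega> in M. ((\<lambda>\<rho>. log 2 (F \<rho> \<omega>) / log 2 \<rho>) \<longlongrightarrow> 1) at_top"
      using pos
    proof eventually_elim
      case (elim \<omega>)
      \<comment> \<open>Each factor is regrouped as 1 plus a positive coefficient times \<rho>, the
        shape of \<open>slope_quotient_linear\<close>.\<close>
      have "((\<lambda>\<rho>. log 2 ((1 + X \<omega> * Y \<omega> / (X \<omega> + \<beta>) * \<rho>) * (1 + \<xi> * X \<omega> * Y \<omega> / (Y \<omega> + \<beta>) * \<rho>)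
           / (1 + (\<xi> * X \<omega> + Y \<omega>) * \<rho>)) / log 2 \<rho>) \<longlongrightarrow> 1) at_top"
        using elim \<beta>0 \<xi> by (intro slope_quotient_linear) (auto simp: add_pos_pos)
      then show ?case by (simp add: F_def mult_ac)
    qed
    show "AE \<omega> in M. 0 \<le> Y \<omega> \<and> 0 \<le> \<xi> * X \<omega>"
      using pos by eventually_elim (use \<xi> in auto)
  qed (use assms in auto)
  then have "((\<lambda>\<rho>. (1 - p) * ((\<integral>\<omega>. pos_part ((1 - \<alpha>) / 2 * log 2 (F \<rho> \<omega>)) \<partial>M) / log 2 \<rho>))
          \<longlongrightarrow> (1 - p) * ((1 - \<alpha>) / 2 * 1)) at_top"
    by (rule tendsto_mult_left)
  then show ?thesis
    by (simp add: R_Sec_WoJ_def Let_def F_def \<beta>_def)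
qed

lemma (in prob_space) R_Act_FJ_slope:
  fixes X Y Z W U :: "'a \<Rightarrow> real"
  assumes "\<alpha> \<le> 1" and \<beta>: "0 < eh_beta \<alpha> \<eta>" and \<xi>: "0 < \<xi>"
    and int: "integrable M X" "integrable M Y"
    and [measurable]: "Z \<in> borel_measurable M" "W \<in> borel_measurable M" "U \<in> borel_measurable M"
    and pos: "AE \<omega> in M. 0 < X \<omega> \<and> 0 < Y \<omega> \<and> 0 < Z \<omega> \<and> 0 < W \<omega> \<and> 0 < U \<omega>"
  shows "((\<lambda>\<rho>. R_Act_FJ M \<alpha> \<eta> \<xi> X Y Z W U \<rho> / log 2 \<rho>) \<longlongrightarrow> 1 - \<alpha>) at_top"
proof -
  define \<beta> where "\<beta> = eh_beta \<alpha> \<eta>"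
  have \<beta>0: "0 < \<beta>" using \<beta> by (simp add: \<beta>_def)
  \<comment> \<open>The jamming term shared by both source SNRs. It does not depend on \<rho>, so
    \<open>q \<omega> + \<beta>\<close> can take the place that \<beta> has without jamming.\<close>
  define q where "q \<omega> = (\<xi> * Z \<omega> + W \<omega>) / (\<xi> * X \<omega> + Y \<omega>) * U \<omega>" for \<omega>
  define F where "F \<rho> \<omega> =
     (1 + \<rho> * X \<omega> * Y \<omega> / (X \<omega> + (q \<omega> + \<beta>))) * (1 + \<xi> * \<rho> * X \<omega> * Y \<omega> / (Y \<omega> + (q \<omega> + \<beta>)))
     / (1 + \<rho> * (\<xi> * X \<omega> + Y \<omega>) / (inverse \<beta> * \<rho> * (\<xi> * Z \<omega> + W \<omega>) * U \<omega> + 1))" for \<rho> \<omega>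
  have [measurable]: "X \<in> borel_measurable M" "Y \<in> borel_measurable M"
    using int by auto
  \<comment> \<open>Positivity of \<xi> * Z + W and of U makes the coefficient of \<rho> in the
    relay's denominator strictly positive. This keeps the relay's SNR bounded and yields slope 2
    instead of 1.\<close>
  have pos': "AE \<omega> in M. 0 < X \<omega> \<and> 0 < Y \<omega> \<and> 0 < q \<omega> + \<beta> \<and> 0 < \<xi> * Z \<omega> + W \<omega> \<and> 0 < U \<omega>"
    using pos by eventually_elim (use \<xi> \<beta>0 in \<open>auto simp: q_def add_pos_pos\<close>)
  have "((\<lambda>\<rho>. (\<integral>\<omega>. pos_part ((1 - \<alpha>) / 2 * log 2 (F \<rho> \<omega>)) \<partial>M) / log 2 \<rho>)
          \<longlongrightarrow> (1 - \<alpha>) / 2 * 2) at_top"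
  proof (rule ergodic_slope[where S = Y and T = "\<lambda>\<omega>. \<xi> * X \<omega>"])
    show "F \<rho> \<in> borel_measurable M" for \<rho>
      unfolding F_def q_def by measurable
    show "AE \<omega> in M. \<forall>\<rho>\<ge>2. 0 < F \<rho> \<omega> \<and> F \<rho> \<omega> \<le> (1 + \<rho> * Y \<omega>) * (1 + \<rho> * (\<xi> * X \<omega>))"
      using pos'
    proof eventually_elim
      case (elim \<omega>)
      show ?case
      proof (intro allI impI)
        fix \<rho> :: real assume \<rho>: "2 \<le> \<rho>"
        show "0 < F \<rho> \<omega> \<and> F \<rho> \<omega> \<le> (1 + \<rho> * Y \<omega>) * (1 + \<rho> * (\<xi> * X \<omega>))"
          unfolding F_def
          by (rule secrecy_quotient_bounds) (use elim \<rho> \<xi> \<beta>0 in auto)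
      qed
    qed
    show "AE \<omega> in M. ((\<lambda>\<rho>. log 2 (F \<rho> \<omega>) / log 2 \<rho>) \<longlongrightarrow> 2) at_top"
      using pos'
    proof eventually_elim
      case (elim \<omega>)
      have "((\<lambda>\<rho>. log 2 ((1 + X \<omega> * Y \<omega> / (X \<omega> + (q \<omega> + \<beta>)) * \<rho>)
           * (1 + \<xi> * X \<omega> * Y \<omega> / (Y \<omega> + (q \<omega> + \<beta>)) * \<rho>)
           / (1 + (\<xi> * X \<omega> + Y \<omega>) * \<rho> / (inverse \<beta> * (\<xi> * Z \<omega> + W \<omega>) * U \<omega> * \<rho> + 1))) / log 2 \<rho>)
           \<longlongrightarrow> 2) at_top"
        using elim \<beta>0 \<xi> by (intro slope_quotient_bounded) (auto simp: add_pos_pos)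
      then show ?case by (simp add: F_def mult_ac)
    qed
    show "AE \<omega> in M. 0 \<le> Y \<omega> \<and> 0 \<le> \<xi> * X \<omega>"
      using pos by eventually_elim (use \<xi> in auto)
  qed (use assms in auto)
  moreover have "R_Act_FJ M \<alpha> \<eta> \<xi> X Y Z W U \<rho>
      = (\<integral>\<omega>. pos_part ((1 - \<alpha>) / 2 * log 2 (F \<rho> \<omega>)) \<partial>M)" for \<rho>
    by (simp add: R_Act_FJ_def gamma_S1_def gamma_S2_def gamma_R_def Let_def F_def \<beta>_def q_def
        add.assoc)
  ultimately show ?thesis by (simp add: diff_divide_distrib)
qed

theorem mainTheorem6:
  fixes M :: "'a measure"
    and X Y Z W U :: "'a \<Rightarrow> real"
    and \<alpha> \<eta> \<xi> p_R p_J m_x m_y m_z m_w m_u :: real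
  assumes "prob_space M"
    and "0 < \<alpha>" "\<alpha> < 1"
    and "0 < \<eta>" "\<eta> < 1"
    and "0 < \<xi>"
    and "0 \<le> p_R" "p_R \<le> 1"
    and "0 \<le> p_J" "p_J \<le> 1"
    and "0 < m_x" "0 < m_y" "0 < m_z" "0 < m_w" "0 < m_u"
    and "distributed M lborel X (exponential_density (1 / m_x))"
    and "distributed M lborel Y (exponential_density (1 / m_y))"
    and "distributed M lborel Z (exponential_density (1 / m_z))"
    and "distributed M lborel W (exponential_density (1 / m_w))"
    and "distributed M lborel U (exponential_density (1 / m_u))"
    and "prob_space.indep_vars M (\<lambda>_. borel) (\<lambda>i. [X, Y, Z, W, U] ! i) {..<5::nat}"
  shows "((\<lambda>\<rho>. R_Sec_FJ M \<alpha> \<eta> \<xi> p_R p_J X Y Z W U \<rho> / log 2 \<rho>)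
            \<longlongrightarrow> (1 - p_R) * (1 - p_J / 2) * (1 - \<alpha>)) at_top"
proof -
  interpret prob_space M by fact
  note exps = assms(16-20)
  have pos: "AE \<omega> in M. 0 < X \<omega> \<and> 0 < Y \<omega> \<and> 0 < Z \<omega> \<and> 0 < W \<omega> \<and> 0 < U \<omega>"
    using exps[THEN exponential_distributed_AE_pos] by eventually_elim simp
  have int: "integrable M X" "integrable M Y"
    using exponential_distributed_integrable[OF _ exps(1)]
      exponential_distributed_integrable[OF _ exps(2)] assms by auto
  have meas: "Z \<in> borel_measurable M" "W \<in> borel_measurable M" "U \<in> borel_measurable M"
    using exps(3-5)[THEN distributed_measurable] by simp_all
  have \<beta>: "0 < eh_beta \<alpha> \<eta>"
    using assms by (simp add: eh_beta_def)
  have WoJ: "((\<lambda>\<rho>. R_Sec_WoJ M \<alpha> \<eta> \<xi> p_R X Y \<rho> / log 2 \<rho>)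
      \<longlongrightarrow> (1 - p_R) * ((1 - \<alpha>) / 2)) at_top"
    using assms \<beta> int pos by (intro R_Sec_WoJ_slope) auto
  have FJ: "((\<lambda>\<rho>. R_Act_FJ M \<alpha> \<eta> \<xi> X Y Z W U \<rho> / log 2 \<rho>) \<longlongrightarrow> 1 - \<alpha>) at_top"
    using assms \<beta> int meas pos by (intro R_Act_FJ_slope) auto
  have "((\<lambda>\<rho>. p_J * (R_Sec_WoJ M \<alpha> \<eta> \<xi> p_R X Y \<rho> / log 2 \<rho>)
        + (1 - p_R) * (1 - p_J) * (R_Act_FJ M \<alpha> \<eta> \<xi> X Y Z W U \<rho> / log 2 \<rho>))
      \<longlongrightarrow> p_J * ((1 - p_R) * ((1 - \<alpha>) / 2)) + (1 - p_R) * (1 - p_J) * (1 - \<alpha>)) at_top"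
    by (intro tendsto_add tendsto_mult_left WoJ FJ)
  \<comment> \<open>An outage at the jammer halves the slope, so the two cases carry the weight p_J
    / 2 + (1 - p_J) = 1 - p_J / 2.\<close>
  moreover have "p_J * ((1 - p_R) * ((1 - \<alpha>) / 2)) + (1 - p_R) * (1 - p_J) * (1 - \<alpha>)
      = (1 - p_R) * (1 - p_J / 2) * (1 - \<alpha>)"
    by (simp add: field_simps)
  ultimately show ?thesis
    by (simp add: R_Sec_FJ_def add_divide_distrib)
qed

end
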